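(* Let $d,k,m$ be positive integers with $d$ odd, and put $$n(d,k,m)=k+m\sum_{\substack{1\le\delta\le d\\ \delta\equiv 1 \bmod 2}}\binom{\delta+k-1}{\delta}.$$ Suppose $n\ge n(d,k,m)$ and $f:\mathbb R^n\to\mathbb R^m$ is an odd polynomial map whose coordinate functions have degrees $\le d$. Then there exists a $k$-dimensional linear subspace $L\subset\mathbb R^n$ such that $f(x)=0$ for all $x\in L$.
   Context: A polynomial map $f$ is odd if $f(-x)=-f(x)$ for all $x$. *)

theory Defs
  imports "HOL-Analysis.Analysis"
begin

definition multi_indices :: "nat \<Rightarrow> ('n::finite \<Rightarrow> nat) set" where
  "multi_indices d = {\<alpha>. (\<Sum>i\<in>UNIV. \<alpha> i) \<le> d}"

text \<open>The sums over \<open>multi_indices d\<close> below are genuine finite sums:\<close>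

lemma finite_multi_indices: "finite (multi_indices d :: ('n::finite \<Rightarrow> nat) set)"
proof (rule finite_subset)
  show "multi_indices d \<subseteq> (PiE UNIV (\<lambda>_. {..d}) :: ('n \<Rightarrow> nat) set)"
  proof
    fix \<alpha> :: "'n \<Rightarrow> nat"
    assume "\<alpha> \<in> multi_indices d"
    then have "(\<Sum>i\<in>UNIV. \<alpha> i) \<le> d"
      by (simp add: multi_indices_def)
    moreover have "\<alpha> j \<le> (\<Sum>i\<in>UNIV. \<alpha> i)" for j
      by (rule member_le_sum) auto
    ultimately show "\<alpha> \<in> PiE UNIV (\<lambda>_. {..d})"
      by (auto intro: order_trans)
  qed
  show "finite (PiE UNIV (\<lambda>_. {..d}) :: ('n \<Rightarrow> nat) set)"
    by (intro finite_PiE) auto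
qed

text \<open>
  Polynomial functions of total degree at most \<open>d\<close>, as linear combinations of monomials.
  The zero polynomial qualifies for every \<open>d\<close>.
\<close>

definition polynomial_of_degree_le :: "nat \<Rightarrow> (real ^ 'n \<Rightarrow> real) \<Rightarrow> bool" where
  "polynomial_of_degree_le d p \<longleftrightarrow>
     (\<exists>c :: ('n \<Rightarrow> nat) \<Rightarrow> real.
        \<forall>x. p x = (\<Sum>\<alpha>\<in>multi_indices d. c \<alpha> * (\<Prod>i\<in>UNIV. (x $ i) ^ \<alpha> i)))"

definition n_bound :: "nat \<Rightarrow> nat \<Rightarrow> nat \<Rightarrow> nat" where
  "n_bound d k m = k + m * (\<Sum>\<delta> | 1 \<le> \<delta> \<and> \<delta> \<le> d \<and> odd \<delta>. (\<delta> + k - 1) choose \<delta>)"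

end

theory Submission
  imports Defs "HOL-Library.Z2"
begin

text \<open>
  Look for pairwise disjointly supported vectors \<open>v\<^sub>1, \<dots>, v\<^sub>k\<close>, where \<open>v\<^sub>i\<close> ranges over the unit sphere of
  a coordinate subspace of dimension \<open>c\<^sub>i + 1\<close>. The coefficients of \<open>f\<^sub>j (t\<^sub>1 v\<^sub>1 + \<dots> + t\<^sub>k v\<^sub>k)\<close> of odd total
  degree in \<open>t\<close> give \<open>N = n(d,k,m) - k\<close> equations, and the equation of multidegree \<open>a\<close> is odd in \<open>v\<^sub>i\<close> iff
  \<open>a\<^sub>i\<close> is odd. By a Borsuk-Ulam theorem for products of spheres they have a common zero as soon as the
  coefficient of \<open>\<Prod>\<^sub>i x\<^sub>i ^ c\<^sub>i\<close> in \<open>\<Prod>\<^sub>a (\<Sum>\<^sub>i a\<^sub>i x\<^sub>i)\<close> is nonzero modulo 2. Every \<open>a\<close> has an odd entry, so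
  this holds for the lexicographically leading monomial: \<open>c\<^sub>i\<close> is the number of equations for which
  \<open>i\<close> is the first index with \<open>a\<^sub>i\<close> odd.

  For the Borsuk-Ulam theorem, triangulate the product of spheres equivariantly. The sign of each
  function is a 0-cochain whose coboundary is an invariant 1-cocycle, supported on the edges along which
  the function changes sign. The cup product of these cocycles, evaluated on a fundamental chain of the
  product of hemispheres, is the above coefficient. If it is nonzero, some simplex carries a sign change
  of all functions; refining the triangulation yields a common zero by compactness.
\<close>

section \<open>Cochains modulo 2\<close>

text \<open>These default rules rewrite the field operations of \<^typ>\<open>bit\<close> into bit operations.\<close>

declare add_bit_eq_xor [simp del] mult_bit_eq_and [simp del]

lemma bit_add_self [simp]: "a + a = (0::bit)"
  by (cases a) auto

lemma bit_add_left_self [simp]: "a + (a + b) = (b::bit)"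
  by (simp flip: add.assoc)

text \<open>Off-diagonal terms cancel in pairs in characteristic 2.\<close>

lemma bit_sum_symmetric:
  fixes h :: "nat \<Rightarrow> nat \<Rightarrow> bit"
  assumes "\<And>i j. h i j = h j i" "\<And>i. h i i = 0"
  shows "(\<Sum>i<k. \<Sum>j<k. h i j) = 0"
proof (induction k)
  case (Suc k)
  have "(\<Sum>i<Suc k. \<Sum>j<Suc k. h i j)
    = (\<Sum>i<k. \<Sum>j<k. h i j) + ((\<Sum>i<k. h i k) + (\<Sum>j<k. h k j)) + h k k"
    by (simp add: sum.distrib algebra_simps)
  also have "(\<Sum>i<k. h i k) = (\<Sum>j<k. h k j)"
    using assms(1) by simp
  finally show ?case
    using Suc assms(2) by simp
qed simp

text \<open>Mod-2 cochains on simplices given by their list of vertices. The complex is augmented: the empty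
  list is a simplex of dimension \<open>-1\<close>.\<close>

fun coboundary :: "('a list \<Rightarrow> bit) \<Rightarrow> 'a list \<Rightarrow> bit" where
  "coboundary b [] = 0"
| "coboundary b (v # s) = b s + coboundary (\<lambda>t. b (v # t)) s"

lemma coboundary_zero: "coboundary (\<lambda>t. 0) s = 0"
  by (induction s) auto

lemma coboundary_add: "coboundary (\<lambda>t. b t + b' t) s = coboundary b s + coboundary b' s"
  by (induction s arbitrary: b b') (auto simp: algebra_simps)

lemma coboundary_cong:
  assumes "\<And>t. length s = Suc (length t) \<Longrightarrow> set t \<subseteq> set s \<Longrightarrow> b t = b' t"
  shows "coboundary b s = coboundary b' s"
  using assms
proof (induction s arbitrary: b b')
  case (Cons v s)
  have "b s = b' s"
    by (rule Cons.prems) auto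
  moreover have "coboundary (\<lambda>t. b (v # t)) s = coboundary (\<lambda>t. b' (v # t)) s"
    by (rule Cons.IH, rule Cons.prems) auto
  ultimately show ?case
    by simp
qed simp

text \<open>Removing \<open>v\<close> as the first or as the second vertex gives equal terms, which
  cancel; what remains is the same claim for \<open>\<lambda>t. b (v # t)\<close>.\<close>

lemma coboundary_coboundary: "coboundary (coboundary b) s = 0"
proof (induction s arbitrary: b)
  case (Cons v s)
  then show ?case
    by (simp add: coboundary_add)
qed simp

lemma coboundary_map: "coboundary b (map g s) = coboundary (\<lambda>t. b (map g t)) s"
  by (induction s arbitrary: b) auto

lemma coboundary_nonzero:
  assumes "coboundary b s \<noteq> 0"
  shows "\<exists>t. b t \<noteq> 0 \<and> length s = Suc (length t) \<and> set t \<subseteq> set s"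
proof (rule ccontr)
  assume "\<not> ?thesis"
  then have "coboundary b s = coboundary (\<lambda>t. 0) s"
    by (intro coboundary_cong) auto
  with assms show False
    by (simp add: coboundary_zero)
qed

section \<open>Barycentric subdivision of cochains\<close>

text \<open>Dual of the barycentric subdivision of chains, which maps a simplex \<open>s\<close> to the cone with apex
  \<open>bc s\<close> over the subdivision of the boundary of \<open>s\<close>. The numeral argument is the length of \<open>s\<close>.\<close>

primrec subdivide_aux :: "('a list \<Rightarrow> 'a) \<Rightarrow> nat \<Rightarrow> ('a list \<Rightarrow> bit) \<Rightarrow> 'a list \<Rightarrow> bit" where
  "subdivide_aux bc 0 b s = b s"
| "subdivide_aux bc (Suc n) b s = coboundary (subdivide_aux bc n (\<lambda>t. b (bc s # t))) s"

definition subdivide :: "('a list \<Rightarrow> 'a) \<Rightarrow> ('a list \<Rightarrow> bit) \<Rightarrow> 'a list \<Rightarrow> bit" where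
  "subdivide bc b s = subdivide_aux bc (length s) b s"

lemma subdivide_aux_add: "subdivide_aux bc n (\<lambda>t. b t + b' t)
    = (\<lambda>s. subdivide_aux bc n b s + subdivide_aux bc n b' s)"
proof (induction n arbitrary: b b')
  case (Suc n)
  show ?case
    by (simp add: fun_eq_iff coboundary_add Suc[of "\<lambda>t. b (bc _ # t)" "\<lambda>t. b' (bc _ # t)"])
qed (simp add: fun_eq_iff)

lemma subdivide_add: "subdivide bc (\<lambda>t. b t + b' t) = (\<lambda>s. subdivide bc b s + subdivide bc b' s)"
  unfolding subdivide_def subdivide_aux_add ..

text \<open>The boundary of a cone is its base plus the cone over the boundary of the base. Here the
  base is a subdivided boundary, so by induction the second term is a double boundary. The index
  drops to \<open>n\<close> because faces of \<open>s\<close> have one vertex less.\<close>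

lemma subdivide_aux_coboundary:
  assumes "length s = Suc n"
  shows "subdivide_aux bc (Suc n) (coboundary b) s = coboundary (subdivide_aux bc n b) s"
  using assms
proof (induction n arbitrary: b s)
  case 0
  then obtain v where "s = [v]"
    by (cases s) auto
  then show ?case
    by simp
next
  case (Suc n)
  let ?b = "\<lambda>t. b (bc s # t)"
  have "coboundary (subdivide_aux bc (Suc n) (coboundary ?b)) s
      = coboundary (coboundary (subdivide_aux bc n ?b)) s"
    using Suc.prems by (intro coboundary_cong Suc.IH) simp
  then show ?case
    by (subst subdivide_aux.simps) (simp only: coboundary.simps subdivide_aux_add coboundary_add
          coboundary_coboundary add_0_right)
qed

lemma subdivide_coboundary: "subdivide bc (coboundary b) = coboundary (subdivide bc b)"
proof
  fix s
  show "subdivide bc (coboundary b) s = coboundary (subdivide bc b) s"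
  proof (cases "length s")
    case 0
    then show ?thesis
      by (simp add: subdivide_def)
  next
    case (Suc n)
    then have "subdivide bc (coboundary b) s = coboundary (subdivide_aux bc n b) s"
      using subdivide_aux_coboundary[OF Suc] by (simp only: subdivide_def)
    also have "\<dots> = coboundary (subdivide bc b) s"
      using Suc by (intro coboundary_cong) (simp add: subdivide_def)
    finally show ?thesis .
  qed
qed

lemma subdivide_aux_map:
  assumes "\<And>s. s \<noteq> [] \<Longrightarrow> bc (map g s) = g (bc s)"
    and "length s = n"
  shows "subdivide_aux bc n b (map g s) = subdivide_aux bc n (\<lambda>t. b (map g t)) s"
  using assms(2)
proof (induction n arbitrary: b s)
  case (Suc n)
  then have "bc (map g s) = g (bc s)"
    by (intro assms(1)) auto
  then have "subdivide_aux bc (Suc n) b (map g s)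
      = coboundary (\<lambda>t. subdivide_aux bc n (\<lambda>t. b (g (bc s) # t)) (map g t)) s"
    by (simp only: subdivide_aux.simps coboundary_map)
  also have "\<dots> = coboundary (subdivide_aux bc n (\<lambda>t. b (map g (bc s # t)))) s"
    using Suc.prems by (intro coboundary_cong) (simp add: Suc.IH)
  finally show ?case
    by (simp only: subdivide_aux.simps)
qed simp

lemma subdivide_map:
  assumes "\<And>s. s \<noteq> [] \<Longrightarrow> bc (map g s) = g (bc s)"
  shows "subdivide bc b (map g s) = subdivide bc (\<lambda>t. b (map g t)) s"
  using subdivide_aux_map[of bc g, OF assms] by (simp add: subdivide_def)

lemma subdivide_funpow_coboundary: "(subdivide bc ^^ m) (coboundary b) = coboundary ((subdivide bc ^^ m) b)"
  by (induction m) (auto simp: subdivide_coboundary)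

lemma subdivide_funpow_add:
  "(subdivide bc ^^ m) (\<lambda>t. b t + b' t) = (\<lambda>s. (subdivide bc ^^ m) b s + (subdivide bc ^^ m) b' s)"
  by (induction m) (auto simp: subdivide_add)

lemma subdivide_funpow_scale:
  "(subdivide bc ^^ m) (\<lambda>t. a * b t) = (\<lambda>s. a * (subdivide bc ^^ m) b s)"
proof (cases "a = 0")
  case True
  have "(subdivide bc ^^ m) (\<lambda>t. 0) s = 0" for s
    using subdivide_funpow_add[of m bc "\<lambda>t. 0" "\<lambda>t. 0"] by (metis bit_add_self)
  with True show ?thesis
    by auto
qed simp

lemma subdivide_funpow_map:
  assumes "\<And>s. s \<noteq> [] \<Longrightarrow> bc (map g s) = g (bc s)"
  shows "(subdivide bc ^^ m) b (map g s) = (subdivide bc ^^ m) (\<lambda>t. b (map g t)) s"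
proof (induction m arbitrary: s)
  case (Suc m)
  show ?case
    using Suc by (simp add: subdivide_map[of bc g, OF assms])
qed simp

section \<open>Cup products of coboundaries of vertex functions\<close>

text \<open>\<open>cup [f\<^sub>1, \<dots>, f\<^sub>n]\<close> is the cup product \<open>\<delta>f\<^sub>1 \<union> \<dots> \<union> \<delta>f\<^sub>n\<close>, and \<open>vertex_cup f\<^sub>1 [f\<^sub>2, \<dots>, f\<^sub>n]\<close>
  is \<open>f\<^sub>1 \<union> \<delta>f\<^sub>2 \<union> \<dots> \<union> \<delta>f\<^sub>n\<close>.\<close>

fun cup :: "('a \<Rightarrow> bit) list \<Rightarrow> 'a list \<Rightarrow> bit" where
  "cup [] s = of_bool (length s = 1)"
| "cup (f # fs) (u # v # s) = (f u + f v) * cup fs (v # s)"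
| "cup (f # fs) _ = 0"

fun vertex_cup :: "('a \<Rightarrow> bit) \<Rightarrow> ('a \<Rightarrow> bit) list \<Rightarrow> 'a list \<Rightarrow> bit" where
  "vertex_cup f fs [] = 0"
| "vertex_cup f fs (v # s) = f v * cup fs (v # s)"

lemma coboundary_scale: "coboundary (\<lambda>t. a * b t) s = a * coboundary b s"
  by (induction s arbitrary: b) (auto simp: algebra_simps)

text \<open>Only edges have faces of length 1, and an edge has two of them.\<close>

lemma coboundary_cup_Nil: "coboundary (cup []) s = 0"
proof (cases "\<exists>u v w t. s = u # v # w # t")
  case True
  then obtain u v w t where s: "s = u # v # w # t"
    by blast
  have "coboundary (cup []) s = coboundary (\<lambda>t. 0) s"
    by (rule coboundary_cong) (auto simp: s)
  then show ?thesis
    by (simp add: coboundary_zero)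
next
  case False
  then consider "s = []" | v where "s = [v]" | u v where "s = [u, v]"
    by (metis neq_Nil_conv)
  then show ?thesis
    by cases auto
qed

text \<open>Leibniz rule for a 0-cochain times a cocycle. On \<open>u # v # t\<close>, the faces
  that keep the first vertex contribute \<open>f u\<close> times a sum which the cocycle condition
  turns into \<open>cup fs (v # t)\<close>; the face \<open>v # t\<close> contributes
  \<open>f v * cup fs (v # t)\<close>.\<close>

lemma coboundary_vertex_cup_aux:
  assumes "\<And>s. coboundary (cup fs) s = 0"
  shows "coboundary (vertex_cup f fs) s = cup (f # fs) s"
proof (cases "\<exists>u v t. s = u # v # t")
  case True
  then obtain u v t where s: "s = u # v # t"
    by blast
  have "cup fs (v # t) + coboundary (\<lambda>r. cup fs (u # r)) (v # t) = 0"
    using assms[of "u # v # t"] by (simp only: coboundary.simps)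
  then have "coboundary (\<lambda>r. cup fs (u # r)) (v # t) = cup fs (v # t)"
    by (metis add.right_neutral bit_add_left_self)
  then show ?thesis
    unfolding s coboundary.simps(2)[of "vertex_cup f fs"] vertex_cup.simps coboundary_scale cup.simps
    by (simp add: algebra_simps)
next
  case False
  then consider "s = []" | v where "s = [v]"
    by (metis neq_Nil_conv)
  then show ?thesis
    by cases auto
qed

lemma coboundary_cup: "coboundary (cup fs) s = 0"
proof (induction fs arbitrary: s)
  case (Cons f fs)
  then have "cup (f # fs) = coboundary (vertex_cup f fs)"
    using coboundary_vertex_cup_aux[of fs f] by (intro ext) simp
  then show ?case
    by (simp only: coboundary_coboundary)
qed (rule coboundary_cup_Nil)

lemma coboundary_vertex_cup: "coboundary (vertex_cup f fs) = cup (f # fs)"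
  using coboundary_vertex_cup_aux[OF coboundary_cup] by blast

text \<open>Only the differences \<open>f u + f v\<close> enter the product, so constant shifts drop
  out.\<close>

lemma cup_map:
  assumes "\<And>f. f \<in> set fs \<Longrightarrow> \<exists>a. \<forall>v. f (g v) = f v + a"
  shows "cup fs (map g s) = cup fs s"
  using assms
proof (induction fs s rule: cup.induct)
  case (2 f fs u v s)
  then obtain a where "\<And>v. f (g v) = f v + a"
    by (meson list.set_intros(1))
  with 2 show ?case
    by (simp add: algebra_simps)
qed auto

text \<open>The primitive \<open>vertex_cup f fs\<close> of an invariant cocycle need not be
  invariant; its defect drives the recursion in \<open>hemi_eval_subdivide_cup\<close>.\<close>

lemma vertex_cup_map:
  assumes "\<And>f. f \<in> set fs \<Longrightarrow> \<exists>a. \<forall>v. f (g v) = f v + a"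
    and "\<And>v. f (g v) = f v + a"
  shows "vertex_cup f fs (map g s) = vertex_cup f fs s + a * cup fs s * of_bool (s \<noteq> [])"
proof (cases s)
  case (Cons v t)
  have "vertex_cup f fs (map g s) = f (g v) * cup fs (map g s)"
    by (simp only: Cons list.map vertex_cup.simps)
  also have "\<dots> = (f v + a) * cup fs s"
    by (simp only: cup_map[OF assms(1)] assms(2))
  finally show ?thesis
    by (simp add: Cons algebra_simps)
qed simp

text \<open>Each factor is evaluated on one edge of the simplex, and no factor of a nonzero product
  vanishes.\<close>

lemma cup_nonzero:
  assumes "cup fs s \<noteq> 0" "f \<in> set fs"
  shows "\<exists>u\<in>set s. \<exists>v\<in>set s. f u \<noteq> f v"
  using assms
proof (induction fs s rule: cup.induct)
  case (2 g fs u v s)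
  have "(g u + g v) * cup fs (v # s) \<noteq> 0"
    using "2.prems"(1) by (simp only: cup.simps not_False_eq_True)
  then have nz: "g u + g v \<noteq> 0" "cup fs (v # s) \<noteq> 0"
    by (metis mult_zero_left, metis mult_zero_right)
  show ?case
  proof (cases "f = g")
    case True
    have "g u \<noteq> g v"
      using nz(1) by (metis bit_add_self)
    with True show ?thesis
      by (metis list.set_intros)
  next
    case False
    then obtain u' v' where "u' \<in> set (v # s)" "v' \<in> set (v # s)" "f u' \<noteq> f v'"
      using "2.IH"[OF nz(2)] "2.prems"(2) by (metis set_ConsD)
    then show ?thesis
      by (metis list.set_intros(2))
  qed
qed simp_all

section \<open>Evaluation on products of hemispheres\<close>

text \<open>
  \<open>hemi_eval\<close> evaluates a cochain on the fundamental chain \<open>E c\<close> of a product of hemispheres of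
  dimensions \<open>c 0, \<dots>, c (k - 1)\<close>: the cone with apex \<open>p c\<close> over
  \<open>\<Sum>i. (1 + A i) (E (c - e\<^sub>i))\<close>. The numeral argument is the total dimension.
\<close>

primrec hemi_eval :: "((nat \<Rightarrow> nat) \<Rightarrow> 'a) \<Rightarrow> (nat \<Rightarrow> 'a \<Rightarrow> 'a) \<Rightarrow> nat \<Rightarrow> nat \<Rightarrow>
    ('a list \<Rightarrow> bit) \<Rightarrow> (nat \<Rightarrow> nat) \<Rightarrow> bit" where
  "hemi_eval p A k 0 b c = b [p c]"
| "hemi_eval p A k (Suc N) b c = (\<Sum>i<k. if 0 < c i
     then hemi_eval p A k N (\<lambda>t. b (p c # t)) (c(i := c i - 1))
       + hemi_eval p A k N (\<lambda>t. b (p c # map (A i) t)) (c(i := c i - 1)) else 0)"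

lemma hemi_eval_add: "hemi_eval p A k N (\<lambda>t. b t + b' t) c
    = hemi_eval p A k N b c + hemi_eval p A k N b' c"
proof (induction N arbitrary: b b' c)
  case (Suc N)
  show ?case
    unfolding hemi_eval.simps sum.distrib[symmetric]
    by (intro sum.cong refl, rename_tac i, case_tac "0 < c i")
      (simp_all only: Suc if_True if_False add_0_right ac_simps)
qed simp

lemma hemi_eval_scale: "hemi_eval p A k N (\<lambda>t. a * b t) c = a * hemi_eval p A k N b c"
proof (cases "a = 0")
  case True
  then show ?thesis
    using hemi_eval_add[of p A k N "\<lambda>t. 0" "\<lambda>t. 0" c] by simp
qed simp

text \<open>This is the boundary formula for \<open>E c\<close>: the boundary of the cone is its
  base plus the cone over the boundary of the base. The latter consists of the terms
  \<open>(1 + A i) (1 + A j) (E (c - e\<^sub>i - e\<^sub>j))\<close>, which cancel in pairs for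
  distinct \<open>i\<close>, \<open>j\<close> and vanish for \<open>i = j\<close> because
  \<open>(1 + A i)\<^sup>2 = 0\<close> modulo 2.\<close>

lemma hemi_eval_coboundary:
  assumes comm: "\<And>i j v. A i (A j v) = A j (A i v)" and inv: "\<And>i v. A i (A i v) = v"
    and "(\<Sum>i<k. c i) = Suc N"
  shows "hemi_eval p A k (Suc N) (coboundary b) c = (\<Sum>i<k. if 0 < c i
     then hemi_eval p A k N b (c(i := c i - 1)) + hemi_eval p A k N (\<lambda>t. b (map (A i) t)) (c(i := c i - 1))
     else 0)"
  using assms(3)
proof (induction N arbitrary: b c)
  case 0
  \<comment> \<open>Here \<open>y\<close> is the value at the apex, an endpoint of both edges of the
    cone.\<close>
  have "(x + (y + 0)) + (z + (y + 0)) = x + z" for x y z :: bit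
    by (cases x; cases y; cases z) auto
  then show ?case
    by (simp only: hemi_eval.simps coboundary.simps list.map)
next
  case (Suc N)
  define pb where "pb = (\<lambda>t. b (p c # t))"
  define D where "D = (\<lambda>i::nat. c(i := c i - 1))"
  have D_sum: "(\<Sum>j<k. D i j) = Suc N" if "i < k" "0 < c i" for i
  proof -
    have "(\<Sum>j<k. D i j) + (\<Sum>j<k. if j = i then 1 else 0) = (\<Sum>j<k. c j)"
      unfolding sum.distrib[symmetric] D_def using that by (intro sum.cong) auto
    then show ?thesis
      using Suc.prems that by simp
  qed
  define G where "G = (\<lambda>i b. hemi_eval p A k (Suc N) (coboundary b) (D i))"
  define X where "X = (\<lambda>i j b. hemi_eval p A k N b ((D i)(j := D i j - 1)))"
  \<comment> \<open>The four summands expand \<open>(1 + A i) (1 + A j)\<close> on the chain for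
    \<open>c - e\<^sub>i - e\<^sub>j\<close>; the value is 0 if that chain does not exist.\<close>
  define h where "h = (\<lambda>i j. if 0 < c i \<and> 0 < D i j then
     X i j pb + X i j (\<lambda>t. pb (map (A j) t))
     + (X i j (\<lambda>t. pb (map (A i) t)) + X i j (\<lambda>t. pb (map (A i) (map (A j) t)))) else 0)"
  have X_sym: "X i j = X j i" for i j
    by (cases "i = j") (auto simp: X_def D_def fun_upd_twist)
  have comm_t: "(\<lambda>t. pb (map (A i) (map (A j) t))) = (\<lambda>t. pb (map (A j) (map (A i) t)))" for i j
    by (simp add: comm comp_def)
  have cond: "0 < c i \<and> 0 < D i j \<longleftrightarrow> 0 < c j \<and> 0 < D j i" for i j
    by (auto simp: D_def)
  have h_sym: "h i j = h j i" for i j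
    unfolding h_def X_sym[of j i] comm_t[of j i] cond[of j i] by (simp only: ac_simps)
  have h_diag: "h i i = 0" for i
      proof -
    have "map (A i) (map (A i) t) = t" for t
      by (simp add: inv comp_def)
    moreover have "(x + y) + (y + x) = 0" for x y :: bit
      by (cases x; cases y) auto
    ultimately show ?thesis
      by (simp only: h_def if_cancel)
  qed
  have hG: "(if 0 < c i then G i pb + G i (\<lambda>t. pb (map (A i) t)) else 0) = (\<Sum>j<k. h i j)"
    if "i < k" for i
  proof (cases "0 < c i")
    case True
    show ?thesis
      unfolding G_def Suc.IH[OF D_sum[OF that True]] using True
      by (simp add: h_def X_def sum.distrib[symmetric] if_distrib cong: if_cong)
  qed (simp add: h_def)
  have "hemi_eval p A k (Suc (Suc N)) (coboundary b) c = (\<Sum>i<k. if 0 < c i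
     then hemi_eval p A k (Suc N) (\<lambda>t. b t + coboundary pb t) (D i)
        + hemi_eval p A k (Suc N) (\<lambda>t. b (map (A i) t) + coboundary (\<lambda>t. pb (map (A i) t)) t) (D i) else 0)"
    by (simp only: hemi_eval.simps(2)[of p A k "Suc N"] coboundary.simps coboundary_map pb_def D_def)
  also have "\<dots> = (\<Sum>i<k. (if 0 < c i then hemi_eval p A k (Suc N) b (D i)
       + hemi_eval p A k (Suc N) (\<lambda>t. b (map (A i) t)) (D i) else 0)
       + (if 0 < c i then G i pb + G i (\<lambda>t. pb (map (A i) t)) else 0))"
    unfolding hemi_eval_add G_def by (intro sum.cong) (simp_all add: ac_simps)
  also have "\<dots> = (\<Sum>i<k. if 0 < c i then hemi_eval p A k (Suc N) b (D i)
       + hemi_eval p A k (Suc N) (\<lambda>t. b (map (A i) t)) (D i) else 0) + (\<Sum>i<k. \<Sum>j<k. h i j)"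
    unfolding sum.distrib using hG by simp
  also have "(\<Sum>i<k. \<Sum>j<k. h i j) = 0"
    by (rule bit_sum_symmetric[OF h_sym h_diag])
  finally show ?case
    by (simp only: D_def add_0_right)
qed

text \<open>The coefficient of \<open>\<Prod>i. x\<^sub>i ^ c i\<close> in the product of the linear forms \<open>\<Sum>i. a i * x\<^sub>i\<close>,
  \<open>a \<in> set as\<close>, over the field with two elements.\<close>

primrec forms_coeff :: "nat \<Rightarrow> (nat \<Rightarrow> bit) list \<Rightarrow> (nat \<Rightarrow> nat) \<Rightarrow> bit" where
  "forms_coeff k [] c = 1"
| "forms_coeff k (a # as) c = (\<Sum>i<k. if 0 < c i then a i * forms_coeff k as (c(i := c i - 1)) else 0)"

text \<open>The product is the coboundary of \<open>vertex_cup f fs\<close>; moving the coboundary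
  to the chain produces \<open>\<Sum>i. (1 + A i) (E (c - e\<^sub>i))\<close>. Applying
  \<open>1 + A i\<close> to the primitive leaves \<open>a i\<close> times the shorter product, which
  is the recursion of \<open>forms_coeff\<close>. The number of subdivisions does not affect the
  value.\<close>

lemma hemi_eval_subdivide_cup:
  assumes comm: "\<And>i j v. A i (A j v) = A j (A i v)" and inv: "\<And>i v. A i (A i v) = v"
    and bc: "\<And>i s. s \<noteq> [] \<Longrightarrow> bc (map (A i) s) = A i (bc s)"
    and "list_all2 (\<lambda>f a. \<forall>i v. f (A i v) = f v + a i) fs as"
    and "(\<Sum>i<k. c i) = length fs"
  shows "hemi_eval p A k (length fs) ((subdivide bc ^^ m) (cup fs)) c = forms_coeff k as c"
  using assms(4,5)
proof (induction fs as arbitrary: c rule: list_all2_induct)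
  case Nil
  have "(subdivide bc ^^ m) (cup []) [v] = 1" for v
    by (induction m arbitrary: v) (auto simp: subdivide_def)
  then show ?case
    by (simp del: cup.simps)
next
  case (Cons f fs a as)
  let ?S = "\<lambda>b. (subdivide bc ^^ m) b"
  have ex: "\<And>f. f \<in> set fs \<Longrightarrow> \<exists>a. \<forall>v. f (A i v) = f v + a" for i
  proof -
    fix h assume "h \<in> set fs"
    then obtain n where "n < length fs" "h = fs ! n"
      by (auto simp: in_set_conv_nth)
    then have "\<forall>i v. h (A i v) = h v + (as ! n) i"
      using list_all2_nthD[OF Cons(2)] by blast
    then show "\<exists>a. \<forall>v. h (A i v) = h v + a"
      by blast
  qed
  have fa: "\<And>v. f (A i v) = f v + a i" for i
    using Cons(1) by blast
  have "hemi_eval p A k (length (f # fs)) (?S (cup (f # fs))) c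
     = hemi_eval p A k (Suc (length fs)) (coboundary (?S (vertex_cup f fs))) c"
    by (simp only: coboundary_vertex_cup[symmetric] subdivide_funpow_coboundary length_Cons)
  also have "\<dots> = (\<Sum>i<k. if 0 < c i then hemi_eval p A k (length fs) (?S (vertex_cup f fs)) (c(i := c i - 1))
      + hemi_eval p A k (length fs) (\<lambda>t. ?S (vertex_cup f fs) (map (A i) t)) (c(i := c i - 1)) else 0)"
    using Cons.prems by (intro hemi_eval_coboundary[OF comm inv]) simp
  also have "\<dots> = (\<Sum>i<k. if 0 < c i then a i * forms_coeff k as (c(i := c i - 1)) else 0)"
  proof (intro sum.cong if_cong refl)
    fix i assume i: "i \<in> {..<k}" "0 < c i"
    have s: "(\<Sum>j<k. (c(i := c i - 1)) j) = length fs"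
    proof -
      have "(\<Sum>j<k. (c(i := c i - 1)) j) + (\<Sum>j<k. if j = i then 1 else 0) = (\<Sum>j<k. c j)"
        unfolding sum.distrib[symmetric] using i by (intro sum.cong) auto
      then show ?thesis
        using Cons.prems i by simp
    qed
    let ?c = "c(i := c i - 1)"
    have cupNil: "cup fs [] = 0"
      by (cases fs) auto
    have "hemi_eval p A k (length fs) (\<lambda>t. ?S (vertex_cup f fs) (map (A i) t)) ?c
      = hemi_eval p A k (length fs) (?S (\<lambda>t. vertex_cup f fs t + a i * cup fs t)) ?c"
    proof -
      have "vertex_cup f fs (map (A i) t) = vertex_cup f fs t + a i * cup fs t" for t
        using vertex_cup_map[of fs "A i" f "a i" t, OF ex fa] by (cases t) (simp_all add: cupNil)
      moreover have "?S b (map (A i) t) = ?S (\<lambda>t. b (map (A i) t)) t" for b t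
        by (rule subdivide_funpow_map) (rule bc)
      ultimately show ?thesis
        by simp
    qed
    also have "\<dots> = hemi_eval p A k (length fs) (?S (vertex_cup f fs)) ?c
       + a i * hemi_eval p A k (length fs) (?S (cup fs)) ?c"
      by (simp only: subdivide_funpow_add subdivide_funpow_scale hemi_eval_add hemi_eval_scale)
    also have "hemi_eval p A k (length fs) (?S (cup fs)) ?c = forms_coeff k as ?c"
      using Cons.IH[OF s] .
    finally show "hemi_eval p A k (length fs) (?S (vertex_cup f fs)) ?c
      + hemi_eval p A k (length fs) (\<lambda>t. ?S (vertex_cup f fs) (map (A i) t)) ?c = a i * forms_coeff k as ?c"
      by (simp only: bit_add_left_self)
  qed
  finally show ?case
    by simp
qed

text \<open>Here \<open>c\<close> is the exponent of the product of the leading terms. The head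
  \<open>a\<close> has the largest leading index, so \<open>c\<close> vanishes above
  \<open>ld a\<close> while \<open>a\<close> vanishes below it: only \<open>i = ld a\<close>
  contributes.\<close>

lemma forms_coeff_lead:
  assumes "sorted_wrt (\<lambda>a b. ld b \<le> ld a) as"
    and "\<And>a. a \<in> set as \<Longrightarrow> ld a < k \<and> a (ld a) = 1 \<and> (\<forall>i<ld a. a i = 0)"
    and "\<And>i. c i = length (filter (\<lambda>a. ld a = i) as)"
  shows "forms_coeff k as c = 1"
  using assms
proof (induction as arbitrary: c)
  case (Cons a as)
  let ?l = "ld a"
  have a: "?l < k" "a ?l = 1" "\<And>i. i < ?l \<Longrightarrow> a i = 0"
    using Cons.prems(2) by auto
  have c0: "c i = 0" if "i > ?l" for i
    using that Cons.prems(1) unfolding Cons.prems(3) by (auto simp: filter_empty_conv)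
  have "forms_coeff k (a # as) c = (\<Sum>i<k. if i = ?l then forms_coeff k as (c(?l := c ?l - 1)) else 0)"
    unfolding forms_coeff.simps
  proof (rule sum.cong)
    fix i assume "i \<in> {..<k}"
    show "(if 0 < c i then a i * forms_coeff k as (c(i := c i - 1)) else 0)
      = (if i = ?l then forms_coeff k as (c(?l := c ?l - 1)) else 0)"
      using a(2) a(3)[of i] c0[of i] Cons.prems(3)[of i] by (cases i ?l rule: linorder_cases) auto
  qed simp
  also have "\<dots> = forms_coeff k as (c(?l := c ?l - 1))"
    using a(1) by simp
  also have "\<dots> = 1"
    using Cons.prems by (intro Cons.IH) auto
  finally show ?case .
qed simp

section \<open>A Borsuk-Ulam theorem for products of spheres\<close>

text \<open>Averaging over positions allows repeated vertices. Copying the label of the first vertex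
  is an equivariant choice.\<close>

definition barycenter :: "('a::real_normed_vector \<times> 'b) list \<Rightarrow> 'a \<times> 'b" where
  "barycenter s = ((1 / real (length s)) *\<^sub>R (\<Sum>i<length s. fst (s ! i)), snd (hd s))"

lemma barycenter_map:
  assumes "linear h" "s \<noteq> []"
  shows "barycenter (map (\<lambda>v. (h (fst v), g (snd v))) s)
      = (h (fst (barycenter s)), g (snd (barycenter s)))"
  using assms by (simp add: barycenter_def linear_scale linear_sum hd_map)

lemma barycenter_in_hull:
  assumes "s \<noteq> []"
  shows "fst (barycenter s) \<in> convex hull (fst ` set s)"
proof -
  have "(\<Sum>i<length s. (1 / real (length s)) *\<^sub>R fst (s ! i)) \<in> convex hull (fst ` set s)"
    using assms by (intro convex_sum) (auto intro!: hull_inc)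
  then show ?thesis
    by (simp add: barycenter_def scaleR_sum_right)
qed

text \<open>The difference between the barycenter and a vertex is an average in which one of the
  \<open>L\<close> terms is zero; convexity of balls extends the bound to the hull. Using
  \<open>M\<close> in place of the length gives one contraction factor for all faces.\<close>

lemma dist_barycenter_le:
  assumes D: "\<And>u v. u \<in> set s \<Longrightarrow> v \<in> set s \<Longrightarrow> dist (fst u) (fst v) \<le> D"
    and M: "length s \<le> M" and y: "y \<in> convex hull (fst ` set s)"
  shows "dist (fst (barycenter s)) y \<le> (1 - 1 / real M) * D"
proof -
  have ne: "s \<noteq> []"
    using y by auto
  define L where "L = length s"
  have L: "0 < L"
    using ne by (simp add: L_def)
  have D0: "0 \<le> D"
    using D[of "hd s" "hd s"] ne by simp
  have "dist (fst (barycenter s)) (fst v) \<le> (1 - 1 / real M) * D" if v: "v \<in> set s" for v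
  proof -
    obtain j where j: "j < L" "v = s ! j"
      using v unfolding L_def by (metis in_set_conv_nth)
    have "fst (barycenter s) - fst v = (1 / real L) *\<^sub>R (\<Sum>i<L. fst (s ! i) - fst v)"
      using L by (simp add: barycenter_def L_def[symmetric] sum_subtractf scaleR_diff_right
          sum_constant_scaleR)
    also have "norm \<dots> = (1 / real L) * norm (\<Sum>i<L. fst (s ! i) - fst v)"
      by simp
    also have "(\<Sum>i<L. fst (s ! i) - fst v) = (\<Sum>i\<in>{..<L} - {j}. fst (s ! i) - fst v)"
      using j by (intro sum.mono_neutral_right) auto
    also have "norm \<dots> \<le> real (card ({..<L} - {j})) * D"
      using D j that by (intro sum_norm_bound) (auto simp: L_def dist_norm)
    also have "card ({..<L} - {j}) = L - 1"
      using j by simp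
    finally have "dist (fst (barycenter s)) (fst v) \<le> (1 / real L) * (real (L - 1) * D)"
      using L by (simp add: dist_norm divide_right_mono)
    also have "\<dots> = (1 - 1 / real L) * D"
      using L by (simp add: field_simps)
    also have "\<dots> \<le> (1 - 1 / real M) * D"
      using L M D0 by (intro mult_right_mono) (auto simp: L_def frac_le)
    finally show ?thesis .
  qed
  then have "convex hull (fst ` set s) \<subseteq> cball (fst (barycenter s)) ((1 - 1 / real M) * D)"
    by (intro hull_minimal) auto
  with y show ?thesis
    by auto
qed

text \<open>A nonzero value of the subdivided cochain at \<open>s\<close> must come from a simplex
  \<open>t\<close> of the subdivision of \<open>s\<close> on which \<open>b\<close> is
  nonzero.\<close>

lemma subdivide_aux_nonzero:
  assumes "subdivide_aux barycenter n b s \<noteq> 0" "length s = n" "n \<le> M"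
    and "\<And>u v. u \<in> set s \<Longrightarrow> v \<in> set s \<Longrightarrow> dist (fst u) (fst v) \<le> D"
  shows "\<exists>t. b t \<noteq> 0 \<and> length t = n \<and> fst ` set t \<subseteq> convex hull (fst ` set s) \<and>
    (\<forall>u\<in>set t. \<forall>v\<in>set t. dist (fst u) (fst v) \<le> (1 - 1 / real M) * D)"
  using assms
proof (induction n arbitrary: b s)
  case 0
  then show ?case
    by (intro exI[of _ "[]"]) auto
next
  case (Suc n)
  have ne: "s \<noteq> []"
    using Suc.prems by auto
  obtain r where r: "subdivide_aux barycenter n (\<lambda>t. b (barycenter s # t)) r \<noteq> 0" "length s = Suc (length r)"
      "set r \<subseteq> set s"
    using coboundary_nonzero Suc.prems(1) unfolding subdivide_aux.simps by blast
  have lr: "length r = n" and le: "n \<le> M"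
    using r(2) Suc.prems(2,3) by auto
  have dr: "\<And>u v. u \<in> set r \<Longrightarrow> v \<in> set r \<Longrightarrow> dist (fst u) (fst v) \<le> D"
    using r(3) Suc.prems(4) by blast
  obtain t where t: "b (barycenter s # t) \<noteq> 0" "length t = n" "fst ` set t \<subseteq> convex hull (fst ` set r)"
      "\<And>u v. u \<in> set t \<Longrightarrow> v \<in> set t \<Longrightarrow> dist (fst u) (fst v) \<le> (1 - 1 / real M) * D"
    using Suc.IH[OF r(1) lr le dr] by blast
  have "convex hull (fst ` set r) \<subseteq> convex hull (fst ` set s)"
    using r(3) by (intro hull_mono) auto
  then have sub: "fst ` set (barycenter s # t) \<subseteq> convex hull (fst ` set s)"
    using t(3) barycenter_in_hull[OF ne] by auto
  have d: "dist (fst (barycenter s)) (fst v) \<le> (1 - 1 / real M) * D" if "v \<in> set (barycenter s # t)" for v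
    using dist_barycenter_le[of s D M "fst v"] sub that Suc.prems(2-4) by auto
  have "dist (fst u) (fst v) \<le> (1 - 1 / real M) * D"
    if "u \<in> set (barycenter s # t)" "v \<in> set (barycenter s # t)" for u v
    using that t(4)[of u v] d[of u] d[of v] by (auto simp: dist_commute)
  then show ?case
    using t(1,2) sub by (intro exI[of _ "barycenter s # t"]) auto
qed

lemma subdivide_funpow_nonzero:
  assumes "(subdivide barycenter ^^ m) b s \<noteq> 0" "length s \<le> M"
    and "\<And>u v. u \<in> set s \<Longrightarrow> v \<in> set s \<Longrightarrow> dist (fst u) (fst v) \<le> D"
  shows "\<exists>t. b t \<noteq> 0 \<and> length t = length s \<and> fst ` set t \<subseteq> convex hull (fst ` set s) \<and>
    (\<forall>u\<in>set t. \<forall>v\<in>set t. dist (fst u) (fst v) \<le> (1 - 1 / real M) ^ m * D)"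
  using assms
proof (induction m arbitrary: s D)
  case 0
  then show ?case
    by (intro exI[of _ s]) (simp add: hull_subset)
next
  case (Suc m)
  have "subdivide_aux barycenter (length s) ((subdivide barycenter ^^ m) b) s \<noteq> 0"
    using Suc.prems(1) by (simp only: funpow.simps o_apply
        subdivide_def[of barycenter "(subdivide barycenter ^^ m) b" s]
        not_False_eq_True)
  then obtain r where r: "(subdivide barycenter ^^ m) b r \<noteq> 0" "length r = length s"
      "fst ` set r \<subseteq> convex hull (fst ` set s)"
      "\<And>u v. u \<in> set r \<Longrightarrow> v \<in> set r \<Longrightarrow> dist (fst u) (fst v) \<le> (1 - 1 / real M) * D"
    using subdivide_aux_nonzero[OF _ refl Suc.prems(2,3), of "(subdivide barycenter ^^ m) b"] by blast
  obtain t where t: "b t \<noteq> 0" "length t = length r" "fst ` set t \<subseteq> convex hull (fst ` set r)"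
      "\<forall>u\<in>set t. \<forall>v\<in>set t. dist (fst u) (fst v) \<le> (1 - 1 / real M) ^ m * ((1 - 1 / real M) * D)"
    using Suc.IH[OF r(1) _ r(4)] r(2) Suc.prems(2) by auto
  have "convex hull (fst ` set r) \<subseteq> convex hull (fst ` set s)"
    using r(3) by (intro hull_minimal) auto
  then show ?case
    using t r(2) by (intro exI[of _ t]) (auto simp: algebra_simps)
qed

section \<open>Reflections of coordinate blocks and the hemisphere chains\<close>

definition flip :: "('n::finite \<Rightarrow> nat) \<Rightarrow> nat \<Rightarrow> real ^ 'n \<Rightarrow> real ^ 'n" where
  "flip bl i x = (\<chi> p. if bl p = i then - x $ p else x $ p)"

lemma linear_flip: "linear (flip bl i)"
  by (rule linearI) (auto simp: flip_def vec_eq_iff)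

text \<open>The label in the second component makes the action free, which lets sign functions be
  defined equivariantly even where the function vanishes.\<close>

definition act :: "('n::finite \<Rightarrow> nat) \<Rightarrow> nat \<Rightarrow> (real ^ 'n) \<times> (nat \<Rightarrow> bit) \<Rightarrow> (real ^ 'n) \<times> (nat \<Rightarrow> bit)"
  where "act bl i v = (flip bl i (fst v), (snd v)(i := snd v i + 1))"

lemma act_commute: "act bl i (act bl j v) = act bl j (act bl i v)"
  by (auto simp: act_def flip_def vec_eq_iff)

lemma act_act: "act bl i (act bl i v) = v"
  by (auto simp: act_def flip_def vec_eq_iff prod_eq_iff fun_eq_iff add.assoc)

lemma barycenter_act: "s \<noteq> [] \<Longrightarrow> barycenter (map (act bl i) s) = act bl i (barycenter s)"
  using barycenter_map[OF linear_flip, of s bl i "\<lambda>g. g(i := g i + 1)"] by (simp add: act_def[abs_def])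

text \<open>In block \<open>i\<close>, with coordinates \<open>q i 0\<close>, \<open>q i 1\<close>,
  and so on, this is the pole of the hemisphere of dimension \<open>c i\<close>.\<close>

definition apex :: "nat \<Rightarrow> (nat \<Rightarrow> nat \<Rightarrow> 'n::finite) \<Rightarrow> (nat \<Rightarrow> nat) \<Rightarrow> (real ^ 'n) \<times> (nat \<Rightarrow> bit)" where
  "apex k q c = (\<Sum>i<k. axis (q i (c i)) 1, \<lambda>_. 0)"

text \<open>The chain lives on a product of boundaries of cross-polytopes: a vertex picks one signed
  basis vector per block, and the signs \<open>\<epsilon>\<close> are common to all vertices of a
  simplex. Sign 1 at the top index \<open>c i\<close> makes the apex of the next cone
  compatible.\<close>

lemma hemi_eval_nonzero:
  assumes "hemi_eval (apex k q) (act bl) k N b c \<noteq> 0"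
    and "\<And>i l. i < k \<Longrightarrow> l \<le> c i \<Longrightarrow> bl (q i l) = i"
  shows "\<exists>t \<epsilon>. b t \<noteq> 0 \<and> length t = Suc N \<and> (\<forall>i<k. \<epsilon> i (c i) = 1) \<and>
    (\<forall>i l. \<epsilon> i l = 1 \<or> \<epsilon> i l = (-1::real)) \<and>
    (\<forall>v\<in>set t. \<exists>c'. (\<forall>i<k. c' i \<le> c i) \<and> fst v = (\<Sum>i<k. \<epsilon> i (c' i) *\<^sub>R axis (q i (c' i)) 1))"
  using assms
proof (induction N arbitrary: b c)
  case 0
  then show ?case
    by (intro exI[of _ "[apex k q c]"] exI[of _ "\<lambda>_ _. 1"]) (auto simp: apex_def)
next
  case (Suc N)
  let ?p = "apex k q"
  obtain i where i: "i < k" "0 < c i"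
    and nz: "hemi_eval ?p (act bl) k N (\<lambda>t. b (?p c # t)) (c(i := c i - 1))
      + hemi_eval ?p (act bl) k N (\<lambda>t. b (?p c # map (act bl i) t)) (c(i := c i - 1)) \<noteq> 0"
  proof -
    obtain i where "i \<in> {..<k}" and nz: "(if 0 < c i then
      hemi_eval ?p (act bl) k N (\<lambda>t. b (?p c # t)) (c(i := c i - 1))
      + hemi_eval ?p (act bl) k N (\<lambda>t. b (?p c # map (act bl i) t)) (c(i := c i - 1)) else 0) \<noteq> 0"
      using Suc.prems(1) unfolding hemi_eval.simps by (rule sum.not_neutral_contains_not_neutral)
    moreover from nz have "0 < c i"
      by (rule contrapos_np) simp
    ultimately show ?thesis
      using that[of i] by (simp only: if_True lessThan_iff not_False_eq_True)
  qed
  define c1 where "c1 = c(i := c i - 1)"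
  \<comment> \<open>\<open>g e\<close> multiplies block \<open>i\<close> by the sign
    \<open>e\<close>.\<close>
  define g where "g = (\<lambda>e::real. if e = 1 then id else act bl i)"
  have "\<exists>e. (e = 1 \<or> e = -1) \<and> hemi_eval ?p (act bl) k N (\<lambda>t. b (?p c # map (g e) t)) c1 \<noteq> 0"
  proof (rule ccontr)
    assume "\<not> ?thesis"
    then have "hemi_eval ?p (act bl) k N (\<lambda>t. b (?p c # map (g 1) t)) c1 = 0"
      "hemi_eval ?p (act bl) k N (\<lambda>t. b (?p c # map (g (-1)) t)) c1 = 0"
      by blast+
    with nz show False
      unfolding c1_def[symmetric] by (simp add: g_def)
  qed
  then obtain e where e: "e = 1 \<or> e = -1"
    and nz: "hemi_eval ?p (act bl) k N (\<lambda>t. b (?p c # map (g e) t)) c1 \<noteq> 0"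
    by blast
  have le: "c1 j \<le> c j" for j
    by (simp add: c1_def)
  have blq: "bl (q j l) = j" if "j < k" "l \<le> c1 j" for j l
    using Suc.prems(2)[OF that(1)] that(2) le[of j] by simp
  from Suc.IH[OF nz blq] obtain t \<epsilon> where t: "b (?p c # map (g e) t) \<noteq> 0" "length t = Suc N"
      and \<epsilon>: "\<And>i. i < k \<Longrightarrow> \<epsilon> i (c1 i) = 1" "\<And>i l. \<epsilon> i l = 1 \<or> \<epsilon> i l = (-1::real)"
      and v: "\<And>v. v \<in> set t \<Longrightarrow> \<exists>c'. (\<forall>i<k. c' i \<le> c1 i) \<and>
        fst v = (\<Sum>i<k. \<epsilon> i (c' i) *\<^sub>R axis (q i (c' i)) 1)"
    by blast
  \<comment> \<open>In block \<open>i\<close> the old signs are multiplied by \<open>e\<close>; the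
    index \<open>c i\<close> does not occur in \<open>t\<close> there and receives the sign of the
    apex.\<close>
  define \<epsilon>' where "\<epsilon>' = (\<lambda>j l. if j = i then if l = c i then 1 else e * \<epsilon> i l else \<epsilon> j l)"
  have s1: "\<epsilon>' j (c j) = 1" if "j < k" for j
    using \<epsilon>(1)[OF that] by (auto simp: \<epsilon>'_def c1_def)
  have s2: "\<epsilon>' j l = 1 \<or> \<epsilon>' j l = -1" for j l
    using \<epsilon>(2) e by (auto simp: \<epsilon>'_def) (metis minus_equation_iff)+
  have "\<exists>c'. (\<forall>i<k. c' i \<le> c i) \<and> fst (g e w) = (\<Sum>i<k. \<epsilon>' i (c' i) *\<^sub>R axis (q i (c' i)) 1)"
    if wt: "w \<in> set t" for w
  proof -
    obtain c' where c': "\<And>i. i < k \<Longrightarrow> c' i \<le> c1 i"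
      and w: "fst w = (\<Sum>i<k. \<epsilon> i (c' i) *\<^sub>R axis (q i (c' i)) 1)"
      using v[OF wt] by blast
    have "fst (g e w) = (\<Sum>j<k. (if j = i then e else 1) *\<^sub>R \<epsilon> j (c' j) *\<^sub>R axis (q j (c' j)) 1)"
    proof (cases "e = 1")
      case True
      then show ?thesis
        by (auto simp: g_def w intro!: sum.cong)
    next
      case False
      have "flip bl i (axis (q j (c' j)) 1) = (if j = i then - 1 else 1) *\<^sub>R axis (q j (c' j)) 1"
        if "j < k" for j
        using blq[OF that c'[OF that]] by (auto simp: flip_def vec_eq_iff axis_def)
      then show ?thesis
        using False e
        by (auto simp: g_def act_def w linear_sum[OF linear_flip] linear_scale[OF linear_flip]
            intro!: sum.cong)
    qed
    also have "\<dots> = (\<Sum>j<k. \<epsilon>' j (c' j) *\<^sub>R axis (q j (c' j)) 1)"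
      using c'[OF i(1)] i by (intro sum.cong) (auto simp: \<epsilon>'_def c1_def)
    finally show ?thesis
      using c' le by (intro exI[of _ c']) (auto intro: order_trans)
  qed
  moreover have "fst (?p c) = (\<Sum>j<k. \<epsilon>' j (c j) *\<^sub>R axis (q j (c j)) 1)"
    using s1 by (simp add: apex_def)
  ultimately show ?case
    using t s1 s2 by (intro exI[of _ "?p c # map (g e) t"] exI[of _ \<epsilon>']) auto
qed

text \<open>A compact set that contains all simplices involved; the lower bounds keep every block of
  a limit point nonzero.\<close>

definition ball_shell :: "nat \<Rightarrow> (nat \<Rightarrow> nat \<Rightarrow> 'n::finite) \<Rightarrow> (nat \<Rightarrow> nat) \<Rightarrow> (real ^ 'n) set" where
  "ball_shell k q c = cball 0 (real k) \<inter> {x. \<forall>i<k. 1 \<le> (\<Sum>l\<le>c i. \<bar>x $ q i l\<bar>)}"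

lemma compact_ball_shell:
  fixes q :: "nat \<Rightarrow> nat \<Rightarrow> 'n::finite"
  shows "compact (ball_shell k q c)"
proof -
  have "{x :: real ^ 'n. \<forall>i<k. 1 \<le> (\<Sum>l\<le>c i. \<bar>x $ q i l\<bar>)} = (\<Inter>i\<in>{..<k}. {x. 1 \<le> (\<Sum>l\<le>c i. \<bar>x $ q i l\<bar>)})"
    by auto
  moreover have "closed {x :: real ^ 'n. 1 \<le> (\<Sum>l\<le>c i. \<bar>x $ q i l\<bar>)}" for i
    by (intro closed_Collect_le continuous_intros)
  ultimately show ?thesis
    unfolding ball_shell_def by (auto intro!: compact_Int_closed)
qed

text \<open>With the signs fixed, the signed coordinate sum of each block is 1 at all vertices,
  hence on the hull, and it bounds the sum of absolute values from below.\<close>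

lemma convex_hull_subset_ball_shell:
  assumes inj: "inj_on (\<lambda>(i, l). q i l) (SIGMA i:{..<k}. {..c i})"
    and \<epsilon>: "\<And>i l. \<epsilon> i l = 1 \<or> \<epsilon> i l = (-1::real)"
    and V: "\<And>x. x \<in> V \<Longrightarrow> \<exists>c'. (\<forall>i<k. c' i \<le> c i) \<and> x = (\<Sum>i<k. \<epsilon> i (c' i) *\<^sub>R axis (q i (c' i)) 1)"
  shows "convex hull V \<subseteq> ball_shell k q c"
proof -
  have abs_sgn: "\<bar>\<epsilon> i l\<bar> = 1" for i l
    using \<epsilon>[of i l] by auto
  let ?H = "\<lambda>i. {x. (\<Sum>l\<le>c i. \<epsilon> i l *\<^sub>R axis (q i l) 1) \<bullet> x = (1::real)}"
  have inner: "(\<Sum>l\<le>c i. \<epsilon> i l *\<^sub>R axis (q i l) 1) \<bullet> x = (\<Sum>l\<le>c i. \<epsilon> i l * x $ q i l)" for i x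
    by (simp add: inner_sum_left inner_axis')
  have "convex (cball 0 (real k) \<inter> (\<Inter>i\<in>{..<k}. ?H i))"
    by (intro convex_Int convex_INT convex_cball convex_hyperplane)
  moreover have "V \<subseteq> cball 0 (real k) \<inter> (\<Inter>i\<in>{..<k}. ?H i)"
  proof
    fix x assume "x \<in> V"
    then obtain c' where c': "\<And>i. i < k \<Longrightarrow> c' i \<le> c i"
      and x: "x = (\<Sum>i<k. \<epsilon> i (c' i) *\<^sub>R axis (q i (c' i)) 1)"
      using V by blast
    have "norm x \<le> real (card {..<k}) * 1"
      unfolding x by (rule sum_norm_bound) (simp add: abs_sgn)
    moreover have "(\<Sum>l\<le>c i. \<epsilon> i l * x $ q i l) = 1" if i: "i < k" for i
    proof -
      have "x $ q i l = (if l = c' i then \<epsilon> i (c' i) else 0)" if l: "l \<le> c i" for l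
      proof -
        have "q i l = q j (c' j) \<longleftrightarrow> j = i \<and> c' j = l" if "j < k" for j
          using inj_onD[OF inj, of "(j, c' j)" "(i, l)"] c'[OF that] that i l by auto
        then have "x $ q i l = (\<Sum>j<k. if j = i then (if l = c' i then \<epsilon> i (c' i) else 0) else 0)"
          unfolding x sum_component by (intro sum.cong) (auto simp: axis_def)
        then show ?thesis
          using i by simp
      qed
      then have "(\<Sum>l\<le>c i. \<epsilon> i l * x $ q i l)
        = (\<Sum>l\<le>c i. if l = c' i then \<epsilon> i (c' i) * \<epsilon> i (c' i) else 0)"
        by (intro sum.cong) auto
      also have "\<dots> = 1"
        using c'[OF i] \<epsilon>[of i "c' i"] by auto
      finally show ?thesis .
    qed
    ultimately show "x \<in> cball 0 (real k) \<inter> (\<Inter>i\<in>{..<k}. ?H i)"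
      by (simp add: inner)
  qed
  ultimately have "convex hull V \<subseteq> cball 0 (real k) \<inter> (\<Inter>i\<in>{..<k}. ?H i)"
    by (intro hull_minimal)
  moreover have "1 \<le> (\<Sum>l\<le>c i. \<bar>x $ q i l\<bar>)" if "(\<Sum>l\<le>c i. \<epsilon> i l * x $ q i l) = 1" for i x
    unfolding that[symmetric] by (intro sum_mono) (metis abs_ge_self abs_mult abs_sgn mult_1)
  ultimately show ?thesis
    unfolding ball_shell_def inner by blast
qed

text \<open>Where \<open>F\<close> vanishes, the linear form \<open>a\<close> in the labels supplies
  a value that changes under \<open>act\<close> as the sign of \<open>F\<close> would.\<close>

definition sign_label :: "nat \<Rightarrow> (real ^ 'n \<Rightarrow> real) \<Rightarrow> (nat \<Rightarrow> bit) \<Rightarrow>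
    (real ^ 'n::finite) \<times> (nat \<Rightarrow> bit) \<Rightarrow> bit"
  where "sign_label k F a v = (if F (fst v) > 0 then 0 else if F (fst v) < 0 then 1
    else \<Sum>i<k. a i * snd v i)"

lemma sign_label_act:
  assumes "\<And>x. F (flip bl i x) = (if a i = 0 then F x else - F x)" "a i \<noteq> 0 \<Longrightarrow> i < k"
  shows "sign_label k F a (act bl i v) = sign_label k F a v + a i"
proof -
  have "(\<Sum>j<k. a j * ((snd v)(i := snd v i + 1)) j) = (\<Sum>j<k. a j * snd v j + (if j = i then a i else 0))"
    by (intro sum.cong) (auto simp: algebra_simps)
  also have "\<dots> = (\<Sum>j<k. a j * snd v j) + a i"
    using assms(2) by (cases "a i = 0") (simp_all add: sum.distrib)
  finally show ?thesis
    using assms(1)[of "fst v"] by (cases "a i = 0") (auto simp: sign_label_def act_def)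
qed

theorem Borsuk_Ulam_product_of_spheres:
  fixes q :: "nat \<Rightarrow> nat \<Rightarrow> 'n::finite" and Fs :: "(real ^ 'n \<Rightarrow> real) list"
  assumes inj: "inj_on (\<lambda>(i, l). q i l) (SIGMA i:{..<k}. {..c i})"
    and blq: "\<And>i l. i < k \<Longrightarrow> l \<le> c i \<Longrightarrow> bl (q i l) = i"
    and F: "list_all2 (\<lambda>F a. continuous_on UNIV F \<and> (\<forall>i. a i \<noteq> 0 \<longrightarrow> i < k) \<and>
      (\<forall>i x. F (flip bl i x) = (if a i = 0 then F x else - F x))) Fs as"
    and c: "(\<Sum>i<k. c i) = length Fs" and forms_coeff: "forms_coeff k as c = 1"
  shows "\<exists>x. (\<forall>F\<in>set Fs. F x = 0) \<and> (\<forall>i<k. \<exists>l\<le>c i. x $ q i l \<noteq> 0)"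
proof -
  define fs where "fs = map2 (sign_label k) Fs as"
  have len: "length Fs = length as"
    using F by (rule list_all2_lengthD)
  have lab: "list_all2 (\<lambda>f a. \<forall>i v. f (act bl i v) = f v + a i) fs as"
    using F len unfolding fs_def list_all2_conv_all_nth by (auto intro!: sign_label_act)
  define M where "M = Suc (length fs)"
  have ex: "\<exists>x. x \<in> ball_shell k q c \<and> (\<forall>F\<in>set Fs. \<exists>y z. F y \<le> 0 \<and> 0 \<le> F z \<and>
      dist x y \<le> (1 - 1 / real M) ^ m * (2 * real k) \<and> dist x z \<le> (1 - 1 / real M) ^ m * (2 * real k))" for m
  proof -
    have "hemi_eval (apex k q) (act bl) k (length fs) ((subdivide barycenter ^^ m) (cup fs)) c = 1"
      unfolding forms_coeff[symmetric] using c len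
      by (intro hemi_eval_subdivide_cup act_commute act_act barycenter_act lab) (auto simp: fs_def)
    then have "hemi_eval (apex k q) (act bl) k (length fs) ((subdivide barycenter ^^ m) (cup fs)) c \<noteq> 0"
      by simp
    then obtain s \<epsilon> where s: "(subdivide barycenter ^^ m) (cup fs) s \<noteq> 0" "length s = M"
      and \<epsilon>: "\<And>i l. \<epsilon> i l = 1 \<or> \<epsilon> i l = (-1::real)"
      and v: "\<And>v. v \<in> set s \<Longrightarrow> \<exists>c'. (\<forall>i<k. c' i \<le> c i) \<and>
        fst v = (\<Sum>i<k. \<epsilon> i (c' i) *\<^sub>R axis (q i (c' i)) 1)"
      using hemi_eval_nonzero[of k q bl "length fs" "(subdivide barycenter ^^ m) (cup fs)" c, OF _ blq]
      unfolding M_def by blast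
    have hull: "convex hull (fst ` set s) \<subseteq> ball_shell k q c"
      using v by (intro convex_hull_subset_ball_shell[OF inj \<epsilon>]) auto
    have "dist (fst u) (fst v) \<le> 2 * real k" if "u \<in> set s" "v \<in> set s" for u v
    proof -
      have "fst u \<in> cball 0 (real k)" "fst v \<in> cball 0 (real k)"
        using hull that hull_subset[of "fst ` set s" convex] unfolding ball_shell_def by blast+
      then show ?thesis
        using norm_triangle_ineq4[of "fst u" "fst v"] by (simp add: dist_norm)
    qed
    from subdivide_funpow_nonzero[OF s(1) eq_refl[OF s(2)] this]
    obtain t where t: "cup fs t \<noteq> 0" "length t = M" "fst ` set t \<subseteq> ball_shell k q c"
      "\<And>u v. u \<in> set t \<Longrightarrow> v \<in> set t \<Longrightarrow> dist (fst u) (fst v) \<le> (1 - 1 / real M) ^ m * (2 * real k)"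
      using s(2) hull by (smt (verit) subset_trans)
    have hd: "hd t \<in> set t"
      using t(2) by (intro hd_in_set) (auto simp: M_def)
    show ?thesis
    proof (rule exI[of _ "fst (hd t)"], intro conjI ballI)
      show "fst (hd t) \<in> ball_shell k q c"
        using hd t(3) by auto
      fix G assume "G \<in> set Fs"
      then obtain a where "sign_label k G a \<in> set fs"
      proof -
        obtain i where "i < length Fs" "G = Fs ! i"
          using \<open>G \<in> set Fs\<close> by (auto simp: in_set_conv_nth)
        then have "(G, as ! i) \<in> set (zip Fs as)"
          using len by (auto simp: in_set_zip)
        then show ?thesis
          using that[of "as ! i"] unfolding fs_def by force
      qed
      then obtain u v where uv: "u \<in> set t" "v \<in> set t" "sign_label k G a u \<noteq> sign_label k G a v"
        using cup_nonzero[OF t(1)] by blast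
      \<comment> \<open>Unequal labels may come from zeros of \<open>G\<close>, hence the weak
        inequalities.\<close>
      have "G (fst u) \<le> 0 \<and> 0 \<le> G (fst v) \<or> G (fst v) \<le> 0 \<and> 0 \<le> G (fst u)"
        using uv(3) unfolding sign_label_def by (smt (verit))
      then show "\<exists>y z. G y \<le> 0 \<and> 0 \<le> G z \<and> dist (fst (hd t)) y \<le> (1 - 1 / real M) ^ m * (2 * real k)
          \<and> dist (fst (hd t)) z \<le> (1 - 1 / real M) ^ m * (2 * real k)"
        using t(4)[OF hd uv(1)] t(4)[OF hd uv(2)] by blast
    qed
  qed
  then obtain X where X: "\<And>m. X m \<in> ball_shell k q c"
    and near: "\<And>m F. F \<in> set Fs \<Longrightarrow> \<exists>y z. F y \<le> 0 \<and> 0 \<le> F z \<and>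
      dist (X m) y \<le> (1 - 1 / real M) ^ m * (2 * real k) \<and>
      dist (X m) z \<le> (1 - 1 / real M) ^ m * (2 * real k)"
    by metis
  obtain x r where x: "x \<in> ball_shell k q c" and r: "strict_mono r" "(X \<circ> r) \<longlonglongrightarrow> x"
    using compact_ball_shell X unfolding compact_def by metis
  have "(\<lambda>m. (1 - 1 / real M) ^ m * (2 * real k)) \<longlonglongrightarrow> 0"
    unfolding M_def by (auto intro!: tendsto_mult_left_zero LIMSEQ_realpow_zero)
  then have small: "(\<lambda>m. (1 - 1 / real M) ^ r m * (2 * real k)) \<longlonglongrightarrow> 0"
    using LIMSEQ_subseq_LIMSEQ[OF _ r(1)] by (simp add: o_def)
  have "G x = 0" if G: "G \<in> set Fs" for G
  proof (rule ccontr)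
    assume "G x \<noteq> 0"
    have "continuous_on UNIV G"
      using G list_all2_nthD[OF F] by (auto simp: in_set_conv_nth)
    then have "isCont G x"
      by (simp add: continuous_on_eq_continuous_at)
    \<comment> \<open>Within distance \<open>e\<close> of \<open>x\<close> the strict sign of
      \<open>G x\<close> persists, contradicting the nearby \<open>y\<close> and
      \<open>z\<close>.\<close>
    then obtain e where e: "0 < e" "\<And>y. dist y x < e \<Longrightarrow> dist (G y) (G x) < \<bar>G x\<bar>"
      using zero_less_abs_iff[of "G x"] \<open>G x \<noteq> 0\<close> unfolding continuous_at_eps_delta by blast
    have "\<forall>\<^sub>F m in sequentially. dist (X (r m)) x < e / 2"
      using tendstoD[OF r(2), of "e / 2"] e(1) by simp
    moreover have "\<forall>\<^sub>F m in sequentially. (1 - 1 / real M) ^ r m * (2 * real k) < e / 2"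
      using order_tendstoD(2)[OF small, of "e / 2"] e(1) by simp
    ultimately obtain m where m: "dist (X (r m)) x < e / 2"
        "(1 - 1 / real M) ^ r m * (2 * real k) < e / 2"
      using eventually_happens'[OF sequentially_bot eventually_conj] by blast
    obtain y z where yz: "G y \<le> 0" "0 \<le> G z"
      "dist (X (r m)) y \<le> (1 - 1 / real M) ^ r m * (2 * real k)"
      "dist (X (r m)) z \<le> (1 - 1 / real M) ^ r m * (2 * real k)"
      using near[OF G] by blast
    have "dist y x < e" "dist z x < e"
      using m yz(3,4) dist_triangle3[of y x "X (r m)"] dist_triangle3[of z x "X (r m)"] by linarith+
    from e(2)[OF this(1)] e(2)[OF this(2)] yz(1,2) \<open>G x \<noteq> 0\<close> show False
      unfolding dist_real_def by linarith
  qed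
  moreover have "\<exists>l\<le>c i. x $ q i l \<noteq> 0" if "i < k" for i
  proof (rule ccontr)
    assume "\<not> ?thesis"
    then have "(\<Sum>l\<le>c i. \<bar>x $ q i l\<bar>) = 0"
      by (intro sum.neutral) auto
    with x that show False
      unfolding ball_shell_def by fastforce
  qed
  ultimately show ?thesis
    by blast
qed

section \<open>Multihomogeneous parts of odd polynomials\<close>

definition block_degree :: "('n::finite \<Rightarrow> nat) \<Rightarrow> ('n \<Rightarrow> nat) \<Rightarrow> nat \<Rightarrow> nat" where
  "block_degree bl \<alpha> i = (\<Sum>p | bl p = i. \<alpha> p)"

text \<open>This is \<open>t\<^sub>1 v\<^sub>1 + \<dots> + t\<^sub>k v\<^sub>k\<close>, where the
  \<open>v\<^sub>i\<close> are the parts of \<open>x\<close> supported on single blocks.\<close>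

definition block_scale :: "('n::finite \<Rightarrow> nat) \<Rightarrow> (nat \<Rightarrow> real) \<Rightarrow> real ^ 'n \<Rightarrow> real ^ 'n" where
  "block_scale bl t x = (\<chi> p. t (bl p) * x $ p)"

definition monom_at :: "('n::finite \<Rightarrow> nat) \<Rightarrow> real ^ 'n \<Rightarrow> real" where
  "monom_at \<alpha> x = (\<Prod>p\<in>UNIV. (x $ p) ^ \<alpha> p)"

text \<open>For the polynomial with coefficients \<open>cf\<close>, this is the coefficient of the
  monomial with exponents \<open>a\<close> in \<open>t\<close> after substituting
  \<open>block_scale bl t x\<close>, when all blocks are below \<open>k\<close>.\<close>

definition multihom_part ::
    "('n::finite \<Rightarrow> nat) \<Rightarrow> nat \<Rightarrow> nat \<Rightarrow> (('n \<Rightarrow> nat) \<Rightarrow> real) \<Rightarrow> nat list \<Rightarrow> real ^ 'n \<Rightarrow> real" where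
  "multihom_part bl k d cf a x =
     (\<Sum>\<alpha> | \<alpha> \<in> multi_indices d \<and> map (block_degree bl \<alpha>) [0..<k] = a. cf \<alpha> * monom_at \<alpha> x)"

definition odd_degrees :: "nat \<Rightarrow> nat \<Rightarrow> nat list set" where
  "odd_degrees k d = {a. length a = k \<and> odd (sum_list a) \<and> sum_list a \<le> d}"

lemma monom_at_block_scale:
  assumes "\<And>p. bl p < k"
  shows "monom_at \<alpha> (block_scale bl t x) = (\<Prod>i<k. t i ^ block_degree bl \<alpha> i) * monom_at \<alpha> x"
proof -
  have "(\<Prod>p\<in>UNIV. t (bl p) ^ \<alpha> p) = (\<Prod>i<k. \<Prod>p | p \<in> UNIV \<and> bl p = i. t (bl p) ^ \<alpha> p)"
    using assms by (intro prod.group[symmetric]) auto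
  also have "\<dots> = (\<Prod>i<k. t i ^ block_degree bl \<alpha> i)"
    unfolding block_degree_def power_sum by (intro prod.cong) auto
  finally show ?thesis
    by (simp add: monom_at_def block_scale_def power_mult_distrib prod.distrib)
qed

lemma multihom_part_block_scale:
  assumes "\<And>p. bl p < k"
  shows "multihom_part bl k d cf a (block_scale bl t x)
      = (\<Prod>i<k. t i ^ (a ! i)) * multihom_part bl k d cf a x"
  unfolding multihom_part_def sum_distrib_left
  by (intro sum.cong) (auto simp: monom_at_block_scale[OF assms])

text \<open>The linear form modulo 2 attached to the multidegree \<open>a\<close>, extended by
  zero.\<close>

definition parity :: "nat list \<Rightarrow> nat \<Rightarrow> bit" where
  "parity a i = of_bool (i < length a \<and> odd (a ! i))"

lemma flip_eq_block_scale: "flip bl i = block_scale bl (\<lambda>j. if j = i then -1 else 1)"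
  by (auto simp: flip_def block_scale_def vec_eq_iff fun_eq_iff)

lemma multihom_part_flip:
  assumes "\<And>p. bl p < length a"
  shows "multihom_part bl (length a) d cf a (flip bl i x) =
    (if parity a i = 0 then multihom_part bl (length a) d cf a x
     else - multihom_part bl (length a) d cf a x)"
proof -
  have "(\<Prod>j<length a. (if j = i then -1 else 1) ^ (a ! j))
      = (\<Prod>j<length a. if j = i then (-1) ^ (a ! i) else 1 :: real)"
    by (intro prod.cong) auto
  also have "\<dots> = (if i < length a then (-1) ^ (a ! i) else 1)"
    by simp
  finally show ?thesis
    unfolding flip_eq_block_scale multihom_part_block_scale[OF assms]
    by (auto simp: parity_def uminus_power_if)
qed

lemma continuous_multihom_part: "continuous_on UNIV (multihom_part bl k d cf a)"
  unfolding multihom_part_def monom_at_def by (intro continuous_intros)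

lemma sum_block_degree:
  assumes "\<And>p. bl p < k"
  shows "sum_list (map (block_degree bl \<alpha>) [0..<k]) = (\<Sum>p\<in>UNIV. \<alpha> p)"
proof -
  have "(\<Sum>p\<in>UNIV. \<alpha> p) = (\<Sum>i<k. \<Sum>p | p \<in> UNIV \<and> bl p = i. \<alpha> p)"
    using assms by (intro sum.group[symmetric]) auto
  then show ?thesis
    by (simp add: block_degree_def sum_list_sum_nth atLeast0LessThan)
qed

section \<open>Counting odd multidegrees and grouping monomials by them\<close>

lemma finite_odd_degrees: "finite (odd_degrees k d)"
proof (rule finite_subset)
  show "odd_degrees k d \<subseteq> {xs. set xs \<subseteq> {..d} \<and> length xs = k}"
    unfolding odd_degrees_def using member_le_sum_list order_trans by fastforce
qed (intro finite_lists_length_eq finite_atMost)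

text \<open>Stars and bars for each odd total degree.\<close>

lemma card_odd_degrees:
  "card (odd_degrees k d) = (\<Sum>\<delta> | 1 \<le> \<delta> \<and> \<delta> \<le> d \<and> odd \<delta>. (\<delta> + k - 1) choose \<delta>)"
proof -
  let ?D = "{\<delta>. 1 \<le> \<delta> \<and> \<delta> \<le> d \<and> odd \<delta>}"
  let ?A = "\<lambda>\<delta>. {l :: nat list. length l = k \<and> sum_list l = \<delta>}"
  have fin: "finite (?A \<delta>)" for \<delta>
  proof (rule finite_subset)
    show "?A \<delta> \<subseteq> {xs. set xs \<subseteq> {..\<delta>} \<and> length xs = k}"
      using member_le_sum_list by fastforce
  qed (intro finite_lists_length_eq finite_atMost)
  have "odd_degrees k d = (\<Union>\<delta>\<in>?D. ?A \<delta>)"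
    unfolding odd_degrees_def using odd_pos by fastforce
  then have "card (odd_degrees k d) = (\<Sum>\<delta>\<in>?D. card (?A \<delta>))"
    using fin by (simp only:) (intro card_UN_disjoint, auto)
  then show ?thesis
    by (simp add: card_length_sum_list)
qed

text \<open>In \<open>P x - P (- x) = 2 * P x\<close> the monomials of even degree cancel; the
  others are grouped by their block degrees.\<close>

lemma odd_polynomial_eq_sum_multihom_parts:
  fixes bl :: "'n::finite \<Rightarrow> nat"
  assumes bl: "\<And>p. bl p < k"
    and cf: "\<And>x. P x = (\<Sum>\<alpha>\<in>multi_indices d. cf \<alpha> * monom_at \<alpha> x)"
    and P: "\<And>x. P (- x) = - P x"
  shows "P x = (\<Sum>a\<in>odd_degrees k d. multihom_part bl k d cf a x)"
proof -
  let ?S = "{\<alpha> :: 'n \<Rightarrow> nat. \<alpha> \<in> multi_indices d \<and> odd (\<Sum>p\<in>UNIV. \<alpha> p)}"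
  let ?g = "\<lambda>\<alpha>. map (block_degree bl \<alpha>) [0..<k]"
  have finS: "finite ?S"
    by (rule finite_subset[OF _ finite_multi_indices[of d]]) auto
  have mon: "monom_at \<alpha> (- x) = (-1) ^ (\<Sum>p\<in>UNIV. \<alpha> p) * monom_at \<alpha> x" for \<alpha>
    unfolding monom_at_def power_sum prod.distrib[symmetric]
    by (intro prod.cong) (auto simp flip: power_mult_distrib)
  have "2 * P x = P x - P (- x)"
    by (simp add: P)
  also have "\<dots> = (\<Sum>\<alpha>\<in>multi_indices d. cf \<alpha> * (monom_at \<alpha> x - monom_at \<alpha> (- x)))"
    unfolding cf by (simp add: sum_subtractf right_diff_distrib)
  also have "\<dots> = (\<Sum>\<alpha>\<in>?S. 2 * (cf \<alpha> * monom_at \<alpha> x))"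
    by (intro sum.mono_neutral_cong_right finite_multi_indices) (auto simp: mon uminus_power_if)
  finally have "P x = (\<Sum>\<alpha>\<in>?S. cf \<alpha> * monom_at \<alpha> x)"
    by (simp flip: sum_distrib_left)
  also have "\<dots> = (\<Sum>a\<in>odd_degrees k d. \<Sum>\<alpha> | \<alpha> \<in> ?S \<and> ?g \<alpha> = a. cf \<alpha> * monom_at \<alpha> x)"
    using sum_block_degree[of bl k, OF bl]
    by (intro sum.group[symmetric] finite_odd_degrees finS) (auto simp: odd_degrees_def multi_indices_def)
  also have "\<dots> = (\<Sum>a\<in>odd_degrees k d. multihom_part bl k d cf a x)"
  proof (rule sum.cong[OF refl])
    fix a assume "a \<in> odd_degrees k d"
    then have "\<alpha> \<in> ?S \<and> ?g \<alpha> = a \<longleftrightarrow> \<alpha> \<in> multi_indices d \<and> ?g \<alpha> = a" for \<alpha>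
      using sum_block_degree[of bl k \<alpha>, OF bl] unfolding odd_degrees_def mem_Collect_eq by metis
    then show "(\<Sum>\<alpha> | \<alpha> \<in> ?S \<and> ?g \<alpha> = a. cf \<alpha> * monom_at \<alpha> x) = multihom_part bl k d cf a x"
      by (simp only: multihom_part_def)
  qed
  finally show ?thesis .
qed

text \<open>The parts of \<open>x\<close> in the different blocks are nonzero and pairwise
  orthogonal, so their span has dimension \<open>k\<close>.\<close>

lemma block_scale_subspace:
  fixes x :: "real ^ 'n::finite"
  assumes nz: "\<And>i. i < k \<Longrightarrow> \<exists>p. bl p = i \<and> x $ p \<noteq> 0" and bl: "\<And>p. bl p < k"
  shows "\<exists>L. subspace L \<and> dim L = k \<and> (\<forall>y\<in>L. \<exists>t. y = block_scale bl t x)"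
proof -
  define v where "v = (\<lambda>i. block_scale bl (\<lambda>j. if j = i then 1 else 0) x)"
  have v: "v i $ p = (if bl p = i then x $ p else 0)" for i p
    by (simp add: v_def block_scale_def)
  have v_nz: "v i \<noteq> 0" if "i < k" for i
    using nz[OF that] v by (metis zero_index)
  have orth: "v i \<bullet> v j = 0" if "i \<noteq> j" for i j
    unfolding inner_vec_def using that by (intro sum.neutral) (auto simp: v)
  have inj: "inj_on v {..<k}"
    using orth v_nz by (intro inj_onI) (metis inner_eq_zero_iff lessThan_iff)
  have ind: "independent (v ` {..<k})"
    using orth v_nz by (intro pairwise_orthogonal_independent) (auto simp: pairwise_def orthogonal_def, metis)
  have "\<exists>t. y = block_scale bl t x" if y: "y \<in> span (v ` {..<k})" for y
  proof -
    obtain u where "y = (\<Sum>w\<in>v ` {..<k}. u w *\<^sub>R w)"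
      using y by (auto simp: span_finite)
    then have "y = (\<Sum>i<k. u (v i) *\<^sub>R v i)"
      by (simp add: sum.reindex[OF inj])
    then have "y $ p = u (v (bl p)) * x $ p" for p
      using bl[of p] by (simp add: v if_distrib cong: if_cong)
    then show ?thesis
      by (intro exI[of _ "\<lambda>i. u (v i)"]) (simp add: block_scale_def vec_eq_iff)
  qed
  moreover have "dim (span (v ` {..<k})) = k"
    using ind inj by (simp add: dim_eq_card_independent card_image)
  ultimately show ?thesis
    by (intro exI[of _ "span (v ` {..<k})"]) auto
qed

section \<open>Choice of the blocks and solution of the equations\<close>

lemma sum_length_filter:
  fixes g :: "'a \<Rightarrow> nat"
  assumes "\<And>x. x \<in> set xs \<Longrightarrow> g x < k"
  shows "(\<Sum>i<k. length (filter (\<lambda>x. g x = i) xs)) = length xs"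
  using assms
proof (induction xs)
  case (Cons x xs)
  have "(\<Sum>i<k. length (filter (\<lambda>x. g x = i) (x # xs)))
      = (\<Sum>i<k. length (filter (\<lambda>x. g x = i) xs) + (if i = g x then 1 else 0))"
    by (intro sum.cong) auto
  also have "\<dots> = length xs + 1"
    using Cons by (simp add: sum.distrib)
  finally show ?case
    by simp
qed simp

text \<open>A sphere of dimension \<open>c i\<close> needs \<open>c i + 1\<close> coordinates, which
  accounts for the summand \<open>k\<close>.\<close>

lemma exists_blocks:
  fixes c :: "nat \<Rightarrow> nat"
  assumes "(\<Sum>i<k. c i) + k \<le> CARD('n::finite)" "0 < k"
  shows "\<exists>(q :: nat \<Rightarrow> nat \<Rightarrow> 'n) bl. inj_on (\<lambda>(i, l). q i l) (SIGMA i:{..<k}. {..c i}) \<and>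
    (\<forall>i<k. \<forall>l\<le>c i. bl (q i l) = i) \<and> (\<forall>p. bl p < k)"
proof -
  let ?S = "SIGMA i:{..<k}. {..c i}"
  have "card ?S = (\<Sum>i<k. c i) + k"
    by (simp add: sum.distrib flip: Suc_eq_plus1) (simp add: sum_Suc)
  with assms have "card ?S \<le> card (UNIV :: 'n set)"
    by simp
  then obtain h :: "nat \<times> nat \<Rightarrow> 'n" where h: "inj_on h ?S"
    using card_le_inj[of ?S "UNIV :: 'n set"] by auto
  \<comment> \<open>Leftover coordinates join block 0, which exists because
    \<open>0 < k\<close>.\<close>
  define bl where "bl = (\<lambda>p. if p \<in> h ` ?S then fst (inv_into ?S h p) else 0)"
  have "bl (h (i, l)) = i" if "i < k" "l \<le> c i" for i l
    using that h by (simp add: bl_def)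
  moreover have "bl p < k" for p
  proof (cases "p \<in> h ` ?S")
    case True
    then have "inv_into ?S h p \<in> ?S"
      by (rule inv_into_into)
    then show ?thesis
      using True by (auto simp: bl_def)
  qed (use assms(2) in \<open>simp add: bl_def\<close>)
  moreover have "inj_on (\<lambda>(i, l). h (i, l)) ?S"
    using h by simp
  ultimately show ?thesis
    by (intro exI[of _ "\<lambda>i l. h (i, l)"] exI[of _ bl]) blast
qed

theorem theorem5:
  fixes d k :: nat
    and f :: "real ^ 'n \<Rightarrow> real ^ 'm"
  assumes "d > 0" and "k > 0" and "odd d"
    and "CARD('n) \<ge> n_bound d k CARD('m)"
    and "\<And>j. polynomial_of_degree_le d (\<lambda>x. f x $ j)"
    and "\<And>x. f (- x) = - f x"
  shows "\<exists>L :: (real ^ 'n) set. subspace L \<and> dim L = k \<and> (\<forall>x\<in>L. f x = 0)"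
proof -
  obtain cf where cf: "\<And>j x. f x $ j = (\<Sum>\<alpha>\<in>multi_indices d. cf j \<alpha> * monom_at \<alpha> x)"
    using assms(5) unfolding polynomial_of_degree_le_def monom_at_def by metis
  \<comment> \<open>One equation for each coordinate function and each odd multidegree.\<close>
  define J where "J = (UNIV :: 'm set) \<times> odd_degrees k d"
  have "finite J"
    by (simp add: J_def finite_odd_degrees)
  then obtain xs where xs: "set xs = J" "distinct xs"
    using finite_distinct_list by blast
  define ld where "ld = (\<lambda>b :: nat \<Rightarrow> bit. LEAST i. b i \<noteq> 0)"
  have ld: "ld (parity a) < k \<and> parity a (ld (parity a)) = 1 \<and> (\<forall>i<ld (parity a). parity a i = 0)"
    if a: "a \<in> odd_degrees k d" for a
  proof -
    have "\<exists>i<length a. odd (a ! i)"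
    proof (rule ccontr)
      assume "\<not> ?thesis"
      then have "even (sum_list a)"
        unfolding sum_list_sum_nth by (intro dvd_sum) auto
      with a show False
        by (simp add: odd_degrees_def)
    qed
    then obtain i where i: "i < k" "parity a i \<noteq> 0"
      using a by (auto simp: odd_degrees_def parity_def)
    have "parity a (ld (parity a)) \<noteq> 0" "ld (parity a) \<le> i"
      unfolding ld_def using i(2) by (rule LeastI, rule Least_le)
    moreover have "parity a j = 0" if "j < ld (parity a)" for j
      using not_less_Least[of j "\<lambda>i. parity a i \<noteq> 0"] that unfolding ld_def by blast
    ultimately show ?thesis
      using i(1) by auto
  qed
  \<comment> \<open>Sorting by \<open>k - ld\<close> puts the largest leading index first, as
    \<open>forms_coeff_lead\<close> requires; since \<open>ld < k\<close>, the subtraction does not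
    truncate.\<close>
  define js where "js = sort_key (\<lambda>u. k - ld (parity (snd u))) xs"
  have js: "set js = J" "distinct js"
    using xs by (simp_all add: js_def)
  define as where "as = map (\<lambda>(j, a). parity a) js"
  have as_J: "\<exists>a\<in>odd_degrees k d. b = parity a" if "b \<in> set as" for b
    using that js(1) by (auto simp: as_def J_def)
  have sorted_key: "sorted_wrt (\<lambda>u v. k - ld (parity (snd u)) \<le> k - ld (parity (snd v))) js"
    using sorted_sort_key[of "\<lambda>u. k - ld (parity (snd u))" xs] by (simp only: js_def sorted_map)
  have "sorted_wrt (\<lambda>u v. ld (parity (snd v)) \<le> ld (parity (snd u))) js"
  proof (rule sorted_wrt_mono_rel[OF _ sorted_key])
    fix u v assume "u \<in> set js" "v \<in> set js"
      and le: "k - ld (parity (snd u)) \<le> k - ld (parity (snd v))"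
    then have "ld (parity (snd u)) < k" "ld (parity (snd v)) < k"
      using ld js(1) by (auto simp: J_def)
    with le show "ld (parity (snd v)) \<le> ld (parity (snd u))"
      by linarith
  qed
  then have sorted_as: "sorted_wrt (\<lambda>a b. ld b \<le> ld a) as"
    by (simp add: as_def sorted_wrt_map case_prod_unfold)
  define c where "c = (\<lambda>i. length (filter (\<lambda>a. ld a = i) as))"
  have "forms_coeff k as c = 1"
    using sorted_as by (rule forms_coeff_lead) (use as_J ld in \<open>auto simp: c_def\<close>)
  have sum_c: "(\<Sum>i<k. c i) = length as"
    unfolding c_def using as_J ld by (intro sum_length_filter) blast
  have "length as = CARD('m) * card (odd_degrees k d)"
    using distinct_card[OF js(2)] by (simp add: as_def js(1) J_def card_cartesian_product)
  \<comment> \<open>The number of equations plus \<open>k\<close> is exactly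
    \<open>n_bound\<close>.\<close>
  then have "(\<Sum>i<k. c i) + k \<le> CARD('n)"
    using assms(4) by (simp add: sum_c n_bound_def card_odd_degrees)
  from exists_blocks[OF this assms(2)]
  obtain q :: "nat \<Rightarrow> nat \<Rightarrow> 'n" and bl
    where inj: "inj_on (\<lambda>(i, l). q i l) (SIGMA i:{..<k}. {..c i})"
    and blq_all: "\<forall>i<k. \<forall>l\<le>c i. bl (q i l) = i" and bl_all: "\<forall>p. bl p < k"
    by (elim exE conjE) (rule that)
  have blq: "bl (q i l) = i" if "i < k" "l \<le> c i" for i l
    using blq_all that by blast
  have bl: "bl p < k" for p
    using bl_all ..
  define Fs where "Fs = map (\<lambda>(j, a). multihom_part bl k d (cf j) a) js"
  have "list_all2 (\<lambda>F a. continuous_on UNIV F \<and> (\<forall>i. a i \<noteq> 0 \<longrightarrow> i < k) \<and>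
      (\<forall>i x. F (flip bl i x) = (if a i = 0 then F x else - F x))) Fs as"
  proof -
    have "continuous_on UNIV (multihom_part bl k d (cf j) a) \<and> (\<forall>i. parity a i \<noteq> 0 \<longrightarrow> i < k) \<and>
      (\<forall>i x. multihom_part bl k d (cf j) a (flip bl i x) =
        (if parity a i = 0 then multihom_part bl k d (cf j) a x else - multihom_part bl k d (cf j) a x))"
      if "(j, a) \<in> J" for j a
    proof -
      have "length a = k"
        using that by (simp add: J_def odd_degrees_def)
      then show ?thesis
        using multihom_part_flip[of bl a d "cf j"] bl
        by (auto simp: continuous_multihom_part parity_def)
    qed
    then show ?thesis
      unfolding Fs_def as_def list.rel_map using js(1) by (intro list.rel_refl_strong) auto
  qed
  from Borsuk_Ulam_product_of_spheres[OF inj blq this _ \<open>forms_coeff k as c = 1\<close>]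
  obtain x where x: "\<And>F. F \<in> set Fs \<Longrightarrow> F x = 0" "\<And>i. i < k \<Longrightarrow> \<exists>l\<le>c i. x $ q i l \<noteq> 0"
    using sum_c by (auto simp: Fs_def as_def)
  \<comment> \<open>Scaling the blocks multiplies each multihomogeneous part by a monomial in
    \<open>t\<close>, so the zeros at \<open>x\<close> persist on the whole span.\<close>
  have "f (block_scale bl t x) = 0" for t
  proof -
    have "f y $ j = (\<Sum>a\<in>odd_degrees k d. multihom_part bl k d (cf j) a y)" for y j
      using bl cf assms(6) by (intro odd_polynomial_eq_sum_multihom_parts) auto
    moreover have "multihom_part bl k d (cf j) a x = 0" if "a \<in> odd_degrees k d" for j a
      using x(1) js(1) that by (force simp: Fs_def J_def)
    ultimately show ?thesis
      by (simp add: vec_eq_iff multihom_part_block_scale[of bl k, OF bl])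
  qed
  moreover have "\<exists>p. bl p = i \<and> x $ p \<noteq> 0" if "i < k" for i
    using x(2)[OF that] blq[OF that] by blast
  ultimately show ?thesis
    using block_scale_subspace[of k bl x] bl by metis
qed

end
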